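(* Let $\psi,\phi\in L^2(\mathbb{R}^N)$ be two wavelets (with respect to $\boldsymbol\alpha,\lambda$), let $f,g\in L^2(\mathbb{R}^N)$, let $\sigma>0$ and $r,s\in\mathbb{C}$. Then, for all $\boldsymbol a\in\mathbb{R}^N_0$ and $\boldsymbol b\in\mathbb{R}^N$: (i) (Linearity) $W_\psi^{\boldsymbol\alpha,\lambda}(rf+sg)=r\,W_\psi^{\boldsymbol\alpha,\lambda}f+s\,W_\psi^{\boldsymbol\alpha,\lambda}g$. (ii) (Anti-linearity) $W_{r\psi+s\phi}^{\boldsymbol\alpha,\lambda}f=\overline r\,W_\psi^{\boldsymbol\alpha,\lambda}f+\overline s\,W_\phi^{\boldsymbol\alpha,\lambda}f$. (iii) (Dilation) $(W_\psi^{\boldsymbol\alpha,\lambda}D_\sigma f)(\boldsymbol a,\boldsymbol b)=\dfrac{C'}{\sigma^N}\,(W_\psi^{\boldsymbol\alpha,\lambda/\sigma}f)(\sigma\boldsymbol a,\sigma\boldsymbol b)$, where $D_\sigma f(\boldsymbol t)=f(\sigma\boldsymbol t)$ and $C'=\sigma^{N/2}\,\overline{\left(\dfrac{c(\boldsymbol\alpha_\lambda)}{c(\boldsymbol\alpha_{\lambda/\sigma})}\right)}$. (iv) (Conjugacy) $(W_\psi^{\boldsymbol\alpha,\lambda}\overline f)(\boldsymbol a,\boldsymbol b)=\overline{(W_{\overline\psi}^{-\boldsymbol\alpha,\lambda}f)(\boldsymbol a,\boldsymbol b)}$. (v) (Parity) $(W_\psi^{\boldsymbol\alpha,\lambda}Pf)(\boldsymbol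 a,\boldsymbol b)=(W_\psi^{\boldsymbol\alpha,\lambda}f)(-\boldsymbol a,-\boldsymbol b)$, where $Pf(\boldsymbol x)=f(-\boldsymbol x)$. (vi) (Translation) for $\boldsymbol y\in\mathbb{R}^N$, $$(W_\psi^{\boldsymbol\alpha,\lambda}\tau_{\boldsymbol y}f)(\boldsymbol a,\boldsymbol b)=e_{\boldsymbol\alpha,-\lambda^2}(\boldsymbol b)\,e_{\boldsymbol\alpha,\lambda^2}(\boldsymbol b-\boldsymbol y)\,e_{\boldsymbol\alpha,\lambda^2}(\boldsymbol y)\,(W_\psi^{\boldsymbol\alpha,\lambda}\check f)(\boldsymbol a,\boldsymbol b-\boldsymbol y),$$ where $\tau_{\boldsymbol y}f(\boldsymbol x)=f(\boldsymbol x-\boldsymbol y)$ and $\check f(\boldsymbol t)=f(\boldsymbol t)\,e^{i\lambda^2\sum_{k=1}^N 2a(\alpha_k)t_ky_k}$.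
   Context: $N\ge1$ is an integer, $\lambda\in\mathbb{R}\setminus\{0\}$, $\boldsymbol\alpha=(\alpha_1,\dots,\alpha_N)$ with $\alpha_k\in(-\pi,\pi)\setminus\{0\}$. For $\boldsymbol x\in\mathbb{R}^N$, $|\boldsymbol x|_m=|x_1x_2\cdots x_N|$ and $\mathbb{R}^N_0=\{\boldsymbol x\in\mathbb{R}^N:|\boldsymbol x|_m\ne0\}$. Products and quotients of vectors are componentwise. Put $a(\alpha_k)=\tfrac12\cot\alpha_k$, $c(\alpha_k)=\sqrt{1-i\cot\alpha_k}$, $c(\boldsymbol\alpha_\lambda)=c(\alpha_1)c(\alpha_2)\cdots c(\alpha_N)$ (and likewise with $\lambda$ replaced by $\lambda/\sigma$, or $\boldsymbol\alpha$ by $-\boldsymbol\alpha$), and $e_{\boldsymbol\alpha,\pm\lambda^2}(\boldsymbol x)=e^{\pm i\lambda^2\sum_{k=1}^N a(\alpha_k)x_k^2}$. The multidimensional fractional Fourier transform (MFrFT) is $(\mathfrak F_{\boldsymbol\alpha,\lambda}f)(\boldsymbol\xi)=\int_{\mathbb{R}^N}f(\boldsymbol x)K_{\boldsymbol\alpha,\lambda}(\boldsymbol x,\boldsymbol\xi)\,d\boldsymbol x$ (extended to $L^2(\mathbb{R}^N)$ as usual), with kernel $K_{\boldsymbol\alpha,\lambda}(\boldsymbol x,\boldsymbol\xi)=\frac{c(\boldsymbol\alpha_\lambda)}{(\sqrt{2\pi})^N}e_{\boldsymbol\alpha,\lambda^2}(\boldsymbol x)e_{\boldsymbol\alpha,\lambda^2}(\boldsymbol\xi)e^{-i\lambda^2\sum_{k=1}^N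 x_k\xi_k\csc\alpha_k}$. A wavelet (wavelet admissible function) is a non-zero $\psi\in L^2(\mathbb{R}^N)$ with $\int_{\mathbb{R}^N_0}|(\mathfrak F_{\boldsymbol\alpha,\lambda}\psi)(\boldsymbol u)|^2\frac{d\boldsymbol u}{|\boldsymbol u|_m}<\infty$. The multidimensional fractional wavelet transform (MFrWT) of $f\in L^2(\mathbb{R}^N)$ with respect to $\psi$ is, for $\boldsymbol a\in\mathbb{R}^N_0$, $\boldsymbol b\in\mathbb{R}^N$, $$(W_\psi^{\boldsymbol\alpha,\lambda}f)(\boldsymbol a,\boldsymbol b)=\int_{\mathbb{R}^N}f(\boldsymbol t)\overline{\boldsymbol\Psi_{\boldsymbol\alpha,\lambda,\boldsymbol a,\boldsymbol b}(\boldsymbol t)}\,d\boldsymbol t,\qquad \boldsymbol\Psi_{\boldsymbol\alpha,\lambda,\boldsymbol a,\boldsymbol b}(\boldsymbol t)=\overline{c(\boldsymbol\alpha_\lambda)}\,e_{\boldsymbol\alpha,\lambda^2}(\boldsymbol b)\,e_{\boldsymbol\alpha,-\lambda^2}(\boldsymbol t)\frac{1}{\sqrt{|\boldsymbol a|_m}}\tilde\psi\!\left(\frac{\boldsymbol t-\boldsymbol b}{\boldsymbol a}\right),\qquad \tilde\psi=\psi\,e_{\boldsymbol\alpha,\lambda^2}.$$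
   Formalization: In (iii), the transform with parameter λ/σ on the right keeps the window ψ̃ = ψ e_{α,λ²} (chirped with λ); with ψ̃ formed from λ/σ instead, the identity fails in general when σ ≠ 1 and some cot α_k ≠ 0. *)

theory Defs
  imports "HOL-Analysis.Analysis"
begin

text \<open>
  Vectors of real N-space have type \<^typ>\<open>real ^ 'n\<close>, so that N = CARD('n) is an arbitrary
  integer \<open>\<ge> 1\<close>.  Elements of the Lebesgue spaces are represented by Lebesgue measurable functions.
\<close>

definition mabs :: "real ^ 'n \<Rightarrow> real" where
  "mabs x = \<bar>\<Prod>k\<in>UNIV. x $ k\<bar>"

definition R0 :: "(real ^ 'n) set" where
  "R0 = {x. mabs x \<noteq> 0}"

definition vdivide :: "real ^ 'n \<Rightarrow> real ^ 'n \<Rightarrow> real ^ 'n" where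
  "vdivide x y = (\<chi> k. x $ k / y $ k)"

definition L2 :: "(real ^ 'n \<Rightarrow> complex) set" where
  "L2 = {f. f \<in> borel_measurable lebesgue \<and> integrable lebesgue (\<lambda>x. (cmod (f x))\<^sup>2)}"

definition L2_tendsto :: "(nat \<Rightarrow> real ^ 'n \<Rightarrow> complex) \<Rightarrow> (real ^ 'n \<Rightarrow> complex) \<Rightarrow> bool" where
  "L2_tendsto h f \<longleftrightarrow>
     (\<lambda>j. \<integral>\<^sup>+ x. ennreal ((cmod (h j x - f x))\<^sup>2) \<partial>lebesgue) \<longlonglongrightarrow> 0"

definition a_coef :: "real \<Rightarrow> real" where
  "a_coef \<theta> = cot \<theta> / 2"

definition c_coef :: "real \<Rightarrow> complex" where
  "c_coef \<theta> = csqrt (1 - \<i> * of_real (cot \<theta>))"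

text \<open>
  The constant \<open>c(\<alpha>\<^bsub>lam\<^esub>)\<close>.  By its definition as the product of the \<open>c(\<alpha>\<^sub>k)\<close> it does not depend on
  \<open>lam\<close>; the argument is kept so that \<open>c(\<alpha>\<^bsub>lam\<^esub>)\<close> and \<open>c(\<alpha>\<^bsub>lam/\<sigma>\<^esub>)\<close> can be written as usual.
\<close>

definition c_vec :: "real ^ 'n \<Rightarrow> real \<Rightarrow> complex" where
  "c_vec \<alpha> lam = (\<Prod>k\<in>UNIV. c_coef (\<alpha> $ k))"

text \<open>The chirp \<open>e\<^bsub>\<alpha>,\<mu>\<^esub>\<close>, where \<open>\<mu>\<close> stands for \<open>\<plusminus> lam\<^sup>2\<close>.\<close>

definition chirp :: "real ^ 'n \<Rightarrow> real \<Rightarrow> real ^ 'n \<Rightarrow> complex" where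
  "chirp \<alpha> \<mu> x = exp (\<i> * of_real (\<mu> * (\<Sum>k\<in>UNIV. a_coef (\<alpha> $ k) * (x $ k)\<^sup>2)))"

definition mfrft_kernel ::
    "real ^ 'n \<Rightarrow> real \<Rightarrow> real ^ 'n \<Rightarrow> real ^ 'n \<Rightarrow> complex" where
  "mfrft_kernel \<alpha> lam x \<xi> =
     c_vec \<alpha> lam / of_real (sqrt (2 * pi) ^ CARD('n))
     * chirp \<alpha> (lam\<^sup>2) x * chirp \<alpha> (lam\<^sup>2) \<xi>
     * exp (- \<i> * of_real (lam\<^sup>2 * (\<Sum>k\<in>UNIV. x $ k * \<xi> $ k * (1 / sin (\<alpha> $ k)))))"

definition mfrft ::
    "real ^ 'n \<Rightarrow> real \<Rightarrow> (real ^ 'n \<Rightarrow> complex) \<Rightarrow> real ^ 'n \<Rightarrow> complex" where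
  "mfrft \<alpha> lam f \<xi> = (\<integral> x. f x * mfrft_kernel \<alpha> lam x \<xi> \<partial>lebesgue)"

text \<open>
  \<open>g\<close> is (a representative of) the transform of \<open>f\<close> under the continuous extension of the
  integral transform from the intersection of the two Lebesgue spaces to the square-integrable
  functions.  By density and the Plancherel theorem such a \<open>g\<close> exists for every \<open>f \<in> L2\<close>, and it is
  unique up to null sets.
\<close>

definition has_mfrft ::
    "real ^ 'n \<Rightarrow> real \<Rightarrow> (real ^ 'n \<Rightarrow> complex) \<Rightarrow> (real ^ 'n \<Rightarrow> complex) \<Rightarrow> bool" where
  "has_mfrft \<alpha> lam f g \<longleftrightarrow> g \<in> L2 \<and>
     (\<forall>h. (\<forall>j. h j \<in> L2 \<and> integrable lebesgue (h j)) \<and> L2_tendsto h f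
          \<longrightarrow> L2_tendsto (\<lambda>j. mfrft \<alpha> lam (h j)) g)"

definition wavelet :: "real ^ 'n \<Rightarrow> real \<Rightarrow> (real ^ 'n \<Rightarrow> complex) \<Rightarrow> bool" where
  "wavelet \<alpha> lam \<psi> \<longleftrightarrow> \<psi> \<in> L2 \<and> \<not> (AE x in lebesgue. \<psi> x = 0) \<and>
     (\<exists>g. has_mfrft \<alpha> lam \<psi> g \<and>
          (\<integral>\<^sup>+ u \<in> R0. ennreal ((cmod (g u))\<^sup>2 / mabs u) \<partial>lebesgue) < \<infinity>)"

text \<open>The chirped window \<open>\<psi> e\<^bsub>\<alpha>,lam\<^sup>2\<^esub>\<close>, usually written as \<open>\<psi>\<close> with a tilde.\<close>

definition chirped ::
    "real ^ 'n \<Rightarrow> real \<Rightarrow> (real ^ 'n \<Rightarrow> complex) \<Rightarrow> real ^ 'n \<Rightarrow> complex" where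
  "chirped \<alpha> lam \<psi> x = \<psi> x * chirp \<alpha> (lam\<^sup>2) x"

text \<open>
  The daughter wavelets and the transform are first defined in terms of the chirped window \<open>w\<close>.
  In the dilation law the transform with parameter \<open>lam/\<sigma>\<close> occurs with the same chirped window
  \<open>\<psi> e\<^bsub>\<alpha>,lam\<^sup>2\<^esub>\<close> as on the other side: the law fails in general if the window is chirped with \<open>lam/\<sigma>\<close> instead.
\<close>

definition daughter ::
    "real ^ 'n \<Rightarrow> real \<Rightarrow> (real ^ 'n \<Rightarrow> complex) \<Rightarrow> real ^ 'n \<Rightarrow> real ^ 'n \<Rightarrow> real ^ 'n \<Rightarrow> complex"
  where
  "daughter \<alpha> lam w a b t =
     cnj (c_vec \<alpha> lam) * chirp \<alpha> (lam\<^sup>2) b * chirp \<alpha> (- lam\<^sup>2) t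
     * of_real (1 / sqrt (mabs a)) * w (vdivide (t - b) a)"

definition mfrwt_chirped ::
    "real ^ 'n \<Rightarrow> real \<Rightarrow> (real ^ 'n \<Rightarrow> complex) \<Rightarrow> (real ^ 'n \<Rightarrow> complex)
       \<Rightarrow> real ^ 'n \<Rightarrow> real ^ 'n \<Rightarrow> complex" where
  "mfrwt_chirped \<alpha> lam w f a b = (\<integral> t. f t * cnj (daughter \<alpha> lam w a b t) \<partial>lebesgue)"

definition mfrwt ::
    "real ^ 'n \<Rightarrow> real \<Rightarrow> (real ^ 'n \<Rightarrow> complex) \<Rightarrow> (real ^ 'n \<Rightarrow> complex)
       \<Rightarrow> real ^ 'n \<Rightarrow> real ^ 'n \<Rightarrow> complex" where
  "mfrwt \<alpha> lam \<psi> f a b = mfrwt_chirped \<alpha> lam (chirped \<alpha> lam \<psi>) f a b"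

end

theory Submission
  imports Defs
begin

text \<open>
  The window \<open>\<psi>\<close> enters the transform only through its chirped form \<open>\<psi> e\<close>, where \<open>e\<close> is the chirp of
  rate \<open>lam\<^sup>2\<close>.  The six laws are therefore proved for an arbitrary window \<open>w\<close>, which is taken
  square-integrable in the two linear ones, and then specialised to \<open>w = \<psi> e\<close>.

  Linearity and anti-linearity are those of the integral.  They need the integrands to be integrable,
  which holds because a daughter wavelet is \<open>w\<close> after an affine map times a bounded chirp, hence
  square-integrable, and a product of two square-integrable functions is integrable
  (\<open>integrable_mult_daughter\<close>).

  Dilation, parity and translation are the substitutions \<open>u = \<sigma> t\<close>, \<open>u = - t\<close> and \<open>u = t - y\<close> in the
  Lebesgue integral (\<open>integral_affine_scaleR\<close>).  The argument \<open>(t - b) / a\<close> of the window is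
  invariant if \<open>a\<close> and \<open>b\<close> are changed accordingly, and the exponent of the chirp is a quadratic form:
  scaling by \<open>\<sigma>\<close> multiplies its rate by \<open>\<sigma>\<^sup>2\<close>, a sign change does nothing, and a translation produces
  a bilinear cross term (\<open>chirp_scaleR\<close>, \<open>chirp_minus_arg\<close>, \<open>chirp_add\<close>).

  Conjugacy holds because the cotangent is odd: replacing \<open>\<alpha>\<close> by \<open>- \<alpha>\<close> conjugates the chirps as well
  as the constant \<open>c_vec\<close> (\<open>chirp_minus_angle\<close>, \<open>c_vec_minus\<close>).
\<close>

section \<open>Change of variables under componentwise affine maps\<close>

lemma R0_iff: "c \<in> R0 \<longleftrightarrow> (\<forall>k. c $ k \<noteq> 0)"
  by (simp add: R0_def mabs_def)

lemma mabs_pos: "c \<in> R0 \<Longrightarrow> mabs c > 0"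
  by (simp add: R0_def mabs_def)

lemma mabs_scaleR: "mabs (m *\<^sub>R (c :: real ^ 'n)) = \<bar>m\<bar> ^ CARD('n) * mabs c"
  by (simp add: mabs_def prod.distrib abs_mult power_abs)

lemma mabs_minus: "mabs (- c) = mabs c"
  using mabs_scaleR[of "- 1" c] by simp

lemma prod_Basis_vec:
  fixes h :: "real ^ 'n \<Rightarrow> 'a :: comm_monoid_mult"
  shows "(\<Prod>j\<in>Basis. h j) = (\<Prod>k\<in>UNIV. h (axis k 1))"
proof -
  have B: "Basis = range (\<lambda>k. axis k 1 :: real ^ 'n)"
    by (auto simp: Basis_vec_def)
  have "inj (\<lambda>k. axis k 1 :: real ^ 'n)"
    by (auto simp: inj_on_def axis_eq_axis)
  then show ?thesis
    unfolding B by (subst prod.reindex) (simp_all only: o_def)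
qed

lemma diagonal_map_as_sum_Basis:
  fixes c x :: "real ^ 'n"
  shows "(\<Sum>j\<in>Basis. ((c \<bullet> j) * (x \<bullet> j)) *\<^sub>R j) = (\<chi> k. c $ k * x $ k)"
proof (rule euclidean_eqI)
  fix i :: "real ^ 'n" assume i: "i \<in> Basis"
  then obtain k where k: "i = axis k 1" by (auto simp: Basis_vec_def)
  have "(\<Sum>j\<in>Basis. ((c \<bullet> j) * (x \<bullet> j)) *\<^sub>R j) \<bullet> i = (c \<bullet> i) * (x \<bullet> i)"
    using i by simp
  then show "(\<Sum>j\<in>Basis. ((c \<bullet> j) * (x \<bullet> j)) *\<^sub>R j) \<bullet> i = (\<chi> k. c $ k * x $ k) \<bullet> i"
    by (simp add: k inner_axis)
qed

lemma
  fixes c t :: "real ^ 'n"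
  assumes "c \<in> R0"
  shows lebesgue_affine_vec:
      "lebesgue = density (distr lebesgue lebesgue (\<lambda>x. t + (\<chi> k. c $ k * x $ k))) (\<lambda>_. ennreal (mabs c))"
    and affine_vec_measurable:
      "(\<lambda>x. t + (\<chi> k. c $ k * x $ k)) \<in> lebesgue \<rightarrow>\<^sub>M lebesgue"
proof -
  have nz: "c \<bullet> j \<noteq> 0" if "j \<in> Basis" for j
    using assms that by (auto simp: R0_iff Basis_vec_def inner_axis)
  have "(\<Prod>j\<in>Basis. \<bar>c \<bullet> j\<bar>) = mabs c"
    by (simp add: prod_Basis_vec mabs_def inner_axis abs_prod)
  then show "lebesgue = density (distr lebesgue lebesgue (\<lambda>x. t + (\<chi> k. c $ k * x $ k)))
      (\<lambda>_. ennreal (mabs c))"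
    using lebesgue_affine_euclidean[of "\<lambda>j. c \<bullet> j" t, OF nz]
    by (simp add: diagonal_map_as_sum_Basis)
  show "(\<lambda>x. t + (\<chi> k. c $ k * x $ k)) \<in> lebesgue \<rightarrow>\<^sub>M lebesgue"
    using lebesgue_affine_measurable[of "\<lambda>j. c \<bullet> j" t, OF nz]
    by (simp add: diagonal_map_as_sum_Basis)
qed

lemma measurable_affine_vec_iff:
  fixes f :: "real ^ 'n \<Rightarrow> complex"
  assumes c: "c \<in> R0"
  shows "(\<lambda>x. f (t + (\<chi> k. c $ k * x $ k))) \<in> borel_measurable lebesgue
    \<longleftrightarrow> f \<in> borel_measurable lebesgue"
proof
  assume "f \<in> borel_measurable lebesgue"
  then show "(\<lambda>x. f (t + (\<chi> k. c $ k * x $ k))) \<in> borel_measurable lebesgue"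
    by (rule measurable_compose[OF affine_vec_measurable[OF c]])
next
  \<comment> \<open>The inverse map is \<open>x \<mapsto> u + d x\<close>, again affine with non-zero slopes.\<close>
  define d :: "real ^ 'n" where "d = (\<chi> k. inverse (c $ k))"
  define u :: "real ^ 'n" where "u = (\<chi> k. - t $ k / c $ k)"
  have d: "d \<in> R0"
    using c by (simp add: R0_iff d_def)
  have inv: "t + (\<chi> k. c $ k * (u + (\<chi> k. d $ k * x $ k)) $ k) = x" for x
    using c by (simp add: R0_iff vec_eq_iff d_def u_def field_simps)
  assume "(\<lambda>x. f (t + (\<chi> k. c $ k * x $ k))) \<in> borel_measurable lebesgue"
  from measurable_compose[OF affine_vec_measurable[OF d, of u] this]
  show "f \<in> borel_measurable lebesgue"
    by (simp only: inv)
qed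

lemma integrable_affine_vec_iff:
  fixes f :: "real ^ 'n \<Rightarrow> complex"
  assumes c: "c \<in> R0"
  shows "integrable lebesgue (\<lambda>x. f (t + (\<chi> k. c $ k * x $ k))) \<longleftrightarrow> integrable lebesgue f"
proof (cases "f \<in> borel_measurable lebesgue")
  case True
  have cancel: "integrable lebesgue (\<lambda>x. of_real (mabs c) * g x) \<longleftrightarrow> integrable lebesgue g"
    for g :: "real ^ 'n \<Rightarrow> complex"
  proof
    assume "integrable lebesgue (\<lambda>x. of_real (mabs c) * g x)"
    then have "integrable lebesgue (\<lambda>x. inverse (of_real (mabs c)) * (of_real (mabs c) * g x))"
      by (rule integrable_mult_right)
    moreover have "inverse (of_real (mabs c)) * (of_real (mabs c) * g x) = g x" for x
      using mabs_pos[OF c] by (simp add: field_simps)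
    ultimately show "integrable lebesgue g"
      by simp
  qed (rule integrable_mult_right)
  have "integrable lebesgue f \<longleftrightarrow>
      integrable (density (distr lebesgue lebesgue (\<lambda>x. t + (\<chi> k. c $ k * x $ k)))
        (\<lambda>_. ennreal (mabs c))) f"
    by (rule arg_cong[OF lebesgue_affine_vec[OF c], of "\<lambda>M. integrable M f"])
  also have "\<dots> \<longleftrightarrow> integrable lebesgue (\<lambda>x. f (t + (\<chi> k. c $ k * x $ k)))"
    using True mabs_pos[OF c] affine_vec_measurable[OF c]
    by (subst integrable_density) (simp_all add: integrable_distr_eq scaleR_conv_of_real cancel)
  finally show ?thesis ..
next
  case False
  then have "(\<lambda>x. f (t + (\<chi> k. c $ k * x $ k))) \<notin> borel_measurable lebesgue"
    by (simp only: measurable_affine_vec_iff[OF c] not_False_eq_True)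
  then show ?thesis
    using False by (auto dest!: borel_measurable_integrable)
qed

text \<open>
  The affine map is a bimeasurable bijection, so it preserves integrability in both directions; for
  a non-integrable \<open>f\<close> both integrals take the default value \<open>0\<close>.
\<close>

lemma integral_affine_vec:
  fixes f :: "real ^ 'n \<Rightarrow> complex"
  assumes c: "c \<in> R0"
  shows "(\<integral>x. f x \<partial>lebesgue)
    = of_real (mabs c) * (\<integral>x. f (t + (\<chi> k. c $ k * x $ k)) \<partial>lebesgue)"
proof (cases "integrable lebesgue f")
  case True
  then have f: "f \<in> borel_measurable lebesgue" by simp
  have "(\<integral>x. f x \<partial>lebesgue) =
      (\<integral>x. f x \<partial>density (distr lebesgue lebesgue (\<lambda>x. t + (\<chi> k. c $ k * x $ k)))
        (\<lambda>_. ennreal (mabs c)))"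
    by (rule arg_cong[OF lebesgue_affine_vec[OF c], of "\<lambda>M. integral\<^sup>L M f"])
  also have "\<dots> = of_real (mabs c) * (\<integral>x. f (t + (\<chi> k. c $ k * x $ k)) \<partial>lebesgue)"
    using f mabs_pos[OF c]
    by (simp add: integral_density integral_distr affine_vec_measurable[OF c] less_imp_le
        scaleR_conv_of_real)
  finally show ?thesis .
next
  case False
  then show ?thesis
    using integrable_affine_vec_iff[OF c, of f t] by (simp add: not_integrable_integral_eq)
qed

lemma integral_affine_scaleR:
  fixes f :: "real ^ 'n \<Rightarrow> complex"
  assumes m: "m \<noteq> 0"
  shows "(\<integral>x. f x \<partial>lebesgue)
    = of_real (\<bar>m\<bar> ^ CARD('n)) * (\<integral>x. f (t + m *\<^sub>R x) \<partial>lebesgue)"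
proof -
  define c :: "real ^ 'n" where "c = (\<chi> k. m)"
  have "c \<in> R0" and "mabs c = \<bar>m\<bar> ^ CARD('n)"
    using m by (simp_all add: R0_iff mabs_def c_def power_abs)
  moreover have "t + (\<chi> k. c $ k * x $ k) = t + m *\<^sub>R x" for x
    by (simp add: vec_eq_iff c_def)
  ultimately show ?thesis
    using integral_affine_vec[of c f t] by simp
qed

section \<open>Square-integrable functions\<close>

lemma L2_integrable_mult:
  assumes "f \<in> L2" and "g \<in> L2"
  shows "integrable lebesgue (\<lambda>x. f x * g x)"
proof (rule Bochner_Integration.integrable_bound)
  show "integrable lebesgue (\<lambda>x. (cmod (f x))\<^sup>2 + (cmod (g x))\<^sup>2)"
    using assms by (simp add: L2_def)
  show "(\<lambda>x. f x * g x) \<in> borel_measurable lebesgue"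
    using assms by (auto simp: L2_def)
  have "cmod (f x * g x) \<le> (cmod (f x))\<^sup>2 + (cmod (g x))\<^sup>2" for x
    using sum_squares_bound[of "cmod (f x)" "cmod (g x)"] norm_ge_zero[of "f x * g x"]
    unfolding norm_mult by linarith
  then show "AE x in lebesgue. norm (f x * g x) \<le> norm ((cmod (f x))\<^sup>2 + (cmod (g x))\<^sup>2)"
    by simp
qed

lemma L2_mult_bounded:
  assumes f: "f \<in> L2" and h: "h \<in> borel_measurable lebesgue" and bd: "\<And>x. cmod (h x) \<le> B"
  shows "(\<lambda>x. h x * f x) \<in> L2"
proof -
  have m: "(\<lambda>x. h x * f x) \<in> borel_measurable lebesgue"
    using f h by (auto simp: L2_def)
  have "integrable lebesgue (\<lambda>x. (cmod (h x * f x))\<^sup>2)"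
  proof (rule Bochner_Integration.integrable_bound)
    show "integrable lebesgue (\<lambda>x. B\<^sup>2 * (cmod (f x))\<^sup>2)"
      using f by (simp add: L2_def)
    show "(\<lambda>x. (cmod (h x * f x))\<^sup>2) \<in> borel_measurable lebesgue"
      using m by measurable
    show "AE x in lebesgue. norm ((cmod (h x * f x))\<^sup>2) \<le> norm (B\<^sup>2 * (cmod (f x))\<^sup>2)"
      by (intro AE_I2) (auto simp: norm_mult power_mult_distrib abs_mult
          intro!: mult_right_mono power_mono bd)
  qed
  with m show ?thesis
    by (simp add: L2_def)
qed

lemma L2_cnj: "f \<in> L2 \<Longrightarrow> (\<lambda>x. cnj (f x)) \<in> L2"
  by (auto simp: L2_def
      intro: measurable_compose[OF _ borel_measurable_continuous_onI[OF continuous_on_cnj[OF continuous_on_id]]])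

lemma L2_affine_vec:
  fixes f :: "real ^ 'n \<Rightarrow> complex"
  assumes c: "c \<in> R0" and f: "f \<in> L2"
  shows "(\<lambda>x. f (t + (\<chi> k. c $ k * x $ k))) \<in> L2"
proof -
  \<comment> \<open>The squared modulus is embedded in the complex numbers to fit the change of variables.\<close>
  have "integrable lebesgue (\<lambda>x. complex_of_real ((cmod (f x))\<^sup>2))"
    using f by (simp only: L2_def mem_Collect_eq complex_of_real_integrable_eq)
  then have "integrable lebesgue
      (\<lambda>x. complex_of_real ((cmod (f (t + (\<chi> k. c $ k * x $ k))))\<^sup>2))"
    by (subst integrable_affine_vec_iff[OF c, where f = "\<lambda>y. complex_of_real ((cmod (f y))\<^sup>2)"])
  then show ?thesis
    using f measurable_affine_vec_iff[OF c, of f t]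
    by (simp only: L2_def mem_Collect_eq complex_of_real_integrable_eq)
qed

section \<open>Chirps and the normalising constant\<close>

lemma chirp_minus_arg: "chirp \<alpha> \<mu> (- x) = chirp \<alpha> \<mu> x"
  by (simp add: chirp_def)

lemma cnj_chirp: "cnj (chirp \<alpha> \<mu> x) = chirp \<alpha> (- \<mu>) x"
  by (simp add: chirp_def exp_cnj)

lemma chirp_minus_angle: "chirp (- \<alpha>) \<mu> x = cnj (chirp \<alpha> \<mu> x)"
  unfolding cnj_chirp by (simp add: chirp_def a_coef_def cot_def sum_negf)

lemma chirp_scaleR: "chirp \<alpha> \<mu> (m *\<^sub>R x) = chirp \<alpha> (\<mu> * m\<^sup>2) x"
  by (simp add: chirp_def sum_distrib_left power_mult_distrib mult_ac)

lemma cmod_chirp: "cmod (chirp \<alpha> \<mu> x) = 1"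
  unfolding chirp_def by simp

lemma chirp_cancel: "chirp \<alpha> (- \<mu>) x * chirp \<alpha> \<mu> x = 1"
  by (simp add: chirp_def flip: exp_add)

lemma chirp_add:
  "chirp \<alpha> \<mu> (x + y) = chirp \<alpha> \<mu> x * chirp \<alpha> \<mu> y
     * exp (\<i> * of_real (\<mu> * (\<Sum>k\<in>UNIV. 2 * a_coef (\<alpha> $ k) * x $ k * y $ k)))"
proof -
  have "(\<Sum>k\<in>UNIV. a_coef (\<alpha> $ k) * ((x + y) $ k)\<^sup>2)
      = (\<Sum>k\<in>UNIV. a_coef (\<alpha> $ k) * (x $ k)\<^sup>2) + (\<Sum>k\<in>UNIV. a_coef (\<alpha> $ k) * (y $ k)\<^sup>2)
        + (\<Sum>k\<in>UNIV. 2 * a_coef (\<alpha> $ k) * x $ k * y $ k)"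
    by (simp add: power2_sum algebra_simps flip: sum.distrib)
  then show ?thesis
    by (simp only: chirp_def distrib_left of_real_add exp_add)
qed

lemma chirp_measurable: "chirp \<alpha> \<mu> \<in> borel_measurable lebesgue"
proof -
  have "continuous_on UNIV (chirp \<alpha> \<mu>)"
    unfolding chirp_def by (intro continuous_intros)
  then show ?thesis
    by (simp add: measurable_completion borel_measurable_continuous_onI)
qed

lemma c_coef_nonzero: "c_coef \<theta> \<noteq> 0"
proof -
  have "Re (1 - \<i> * complex_of_real (cot \<theta>)) \<noteq> 0"
    by simp
  then have "1 - \<i> * complex_of_real (cot \<theta>) \<noteq> 0"
    by (metis zero_complex.simps(1))
  then show ?thesis
    by (simp only: c_coef_def csqrt_eq_0 not_False_eq_True)
qed

text \<open>
  The radicand has real part \<open>1\<close>, so it stays off the branch cut of the square root, where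
  conjugation and square root fail to commute.
\<close>

lemma c_coef_minus: "c_coef (- \<theta>) = cnj (c_coef \<theta>)"
proof -
  have "1 - \<i> * complex_of_real (cot \<theta>) \<notin> \<real>\<^sub>\<le>\<^sub>0"
    by (simp add: complex_nonpos_Reals_iff)
  then show ?thesis
    by (simp add: c_coef_def cnj_csqrt cot_def)
qed

lemma c_vec_nonzero: "c_vec \<alpha> lam \<noteq> 0"
  by (simp add: c_vec_def c_coef_nonzero)

lemma c_vec_minus: "c_vec (- \<alpha>) lam = cnj (c_vec \<alpha> lam)"
  by (simp add: c_vec_def c_coef_minus)

lemma chirped_L2: "\<psi> \<in> L2 \<Longrightarrow> chirped \<alpha> lam \<psi> \<in> L2"
  using L2_mult_bounded[OF _ chirp_measurable, of \<psi> \<alpha> "lam\<^sup>2" 1]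
  by (simp add: chirped_def[abs_def] cmod_chirp mult.commute)

section \<open>Laws of the transform with a fixed chirped window\<close>

lemma daughter_L2:
  assumes a: "a \<in> R0" and w: "w \<in> L2"
  shows "daughter \<alpha> lam w a b \<in> L2"
proof -
  \<comment> \<open>As a function of \<open>t\<close>, the argument \<open>(t - b) / a\<close> is an affine map with slopes \<open>1 / a\<^sub>k\<close>.\<close>
  define d where "d = (\<chi> k. inverse (a $ k))"
  define u where "u = (\<chi> k. - b $ k / a $ k)"
  have d: "d \<in> R0"
    using a by (simp add: R0_iff d_def)
  have eq: "vdivide (t - b) a = u + (\<chi> k. d $ k * t $ k)" for t
    by (simp add: vec_eq_iff vdivide_def d_def u_def add_divide_distrib diff_divide_distrib
        divide_inverse left_diff_distrib right_diff_distrib)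
  define h where "h = (\<lambda>t. cnj (c_vec \<alpha> lam) * chirp \<alpha> (lam\<^sup>2) b * chirp \<alpha> (- lam\<^sup>2) t
     * of_real (1 / sqrt (mabs a)))"
  have "h \<in> borel_measurable lebesgue"
    unfolding h_def by (intro borel_measurable_times chirp_measurable borel_measurable_const)
  moreover have "cmod (h t) \<le> cmod (c_vec \<alpha> lam) * (1 / sqrt (mabs a))" for t
    using mabs_pos[OF a] by (simp add: h_def norm_mult norm_divide cmod_chirp)
  ultimately have "(\<lambda>t. h t * w (u + (\<chi> k. d $ k * t $ k))) \<in> L2"
    by (intro L2_mult_bounded[OF L2_affine_vec[OF d w]])
  then show ?thesis
    by (simp add: daughter_def[abs_def] h_def eq)
qed

text \<open>
  Both factors are square-integrable.  Additivity of the transform rests on this, since a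
  non-integrable summand would be assigned the integral \<open>0\<close>.
\<close>

lemma integrable_mult_daughter:
  assumes "a \<in> R0" and "w \<in> L2" and "f \<in> L2"
  shows "integrable lebesgue (\<lambda>t. f t * cnj (daughter \<alpha> lam w a b t))"
  using assms by (intro L2_integrable_mult L2_cnj daughter_L2)

lemma mfrwt_chirped_linear:
  assumes "a \<in> R0" and "w \<in> L2" and "f \<in> L2" and "g \<in> L2"
  shows "mfrwt_chirped \<alpha> lam w (\<lambda>t. r * f t + s * g t) a b
    = r * mfrwt_chirped \<alpha> lam w f a b + s * mfrwt_chirped \<alpha> lam w g a b"
  using assms integrable_mult_daughter[of a w f \<alpha> lam b] integrable_mult_daughter[of a w g \<alpha> lam b]
  by (simp add: mfrwt_chirped_def distrib_right mult.assoc)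

lemma mfrwt_chirped_antilinear_window:
  assumes "a \<in> R0" and "w \<in> L2" and "v \<in> L2" and "f \<in> L2"
  shows "mfrwt_chirped \<alpha> lam (\<lambda>x. r * w x + s * v x) f a b
    = cnj r * mfrwt_chirped \<alpha> lam w f a b + cnj s * mfrwt_chirped \<alpha> lam v f a b"
proof -
  have "f t * cnj (daughter \<alpha> lam (\<lambda>x. r * w x + s * v x) a b t)
      = cnj r * (f t * cnj (daughter \<alpha> lam w a b t))
        + cnj s * (f t * cnj (daughter \<alpha> lam v a b t))" for t
    by (simp add: daughter_def algebra_simps add_divide_distrib)
  then show ?thesis
    using assms integrable_mult_daughter[of a w f \<alpha> lam b] integrable_mult_daughter[of a v f \<alpha> lam b]
    by (simp add: mfrwt_chirped_def)
qed

text \<open>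
  Substituting \<open>u = \<sigma> t\<close> turns the chirp of rate \<open>lam\<^sup>2\<close> into one of rate \<open>(lam/\<sigma>)\<^sup>2\<close>, both in the
  integration variable and in \<open>b\<close>, while \<open>(t - b)/a = (u - \<sigma> b)/(\<sigma> a)\<close> leaves the argument of the
  window unchanged.  The factor \<open>\<sigma>\<close> to the power \<open>N/2\<close> compensates the normalisation \<open>1/sqrt (mabs a)\<close>,
  the factor \<open>\<sigma>\<close> to the power \<open>-N\<close> is the Jacobian, and the quotient of the constants \<open>c_vec\<close> is \<open>1\<close>.
\<close>

lemma mfrwt_chirped_dilation:
  fixes f :: "real ^ 'n \<Rightarrow> complex"
  assumes \<sigma>: "\<sigma> > 0"
  shows "mfrwt_chirped \<alpha> lam w (\<lambda>t. f (\<sigma> *\<^sub>R t)) a b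
    = (of_real (\<sigma> powr (real CARD('n) / 2)) * cnj (c_vec \<alpha> lam / c_vec \<alpha> (lam / \<sigma>)))
      / of_real (\<sigma> ^ CARD('n)) * mfrwt_chirped \<alpha> (lam / \<sigma>) w f (\<sigma> *\<^sub>R a) (\<sigma> *\<^sub>R b)"
proof -
  define F where "F u = f u * cnj (daughter \<alpha> (lam / \<sigma>) w (\<sigma> *\<^sub>R a) (\<sigma> *\<^sub>R b) u)" for u
  define C where "C = of_real (\<sigma> powr (real CARD('n) / 2))
    * cnj (c_vec \<alpha> lam / c_vec \<alpha> (lam / \<sigma>))"
  have c: "c_vec \<alpha> (lam / \<sigma>) = c_vec \<alpha> lam"
    by (simp add: c_vec_def)
  have C: "C = of_real (\<sigma> powr (real CARD('n) / 2))"
    by (simp add: C_def c c_vec_nonzero)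
  have rate: "(lam / \<sigma>)\<^sup>2 * \<sigma>\<^sup>2 = lam\<^sup>2"
    using \<sigma> by (simp add: power_divide)
  have arg: "vdivide (\<sigma> *\<^sub>R t - \<sigma> *\<^sub>R b) (\<sigma> *\<^sub>R a) = vdivide (t - b) a" for t
    using \<sigma> by (simp add: vec_eq_iff vdivide_def flip: right_diff_distrib)
  have "sqrt (\<sigma> ^ CARD('n)) = \<sigma> powr (real CARD('n) / 2)"
    using \<sigma> by (simp add: powr_half_sqrt[symmetric] powr_powr flip: powr_realpow)
  then have root: "\<sigma> powr (real CARD('n) / 2) * (1 / sqrt (mabs (\<sigma> *\<^sub>R a))) = 1 / sqrt (mabs a)"
    using \<sigma> by (simp add: mabs_scaleR real_sqrt_mult)
  have "f (\<sigma> *\<^sub>R t) * cnj (daughter \<alpha> lam w a b t) = C * F (\<sigma> *\<^sub>R t)" for t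
    unfolding F_def daughter_def C chirp_scaleR arg c mult_minus_left rate root[symmetric]
    by simp
  then have "mfrwt_chirped \<alpha> lam w (\<lambda>t. f (\<sigma> *\<^sub>R t)) a b = C * (\<integral>t. F (\<sigma> *\<^sub>R t) \<partial>lebesgue)"
    by (simp add: mfrwt_chirped_def)
  moreover have "(\<integral>u. F u \<partial>lebesgue) = of_real (\<sigma> ^ CARD('n)) * (\<integral>t. F (\<sigma> *\<^sub>R t) \<partial>lebesgue)"
    using integral_affine_scaleR[of \<sigma> F 0] \<sigma> by simp
  ultimately show ?thesis
    using \<sigma> unfolding C_def[symmetric] by (simp add: mfrwt_chirped_def F_def)
qed

lemma mfrwt_chirped_cnj:
  "mfrwt_chirped \<alpha> lam w (\<lambda>t. cnj (f t)) a b
    = cnj (mfrwt_chirped (- \<alpha>) lam (\<lambda>x. cnj (w x)) f a b)"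
proof -
  have "cnj (f t) * cnj (daughter \<alpha> lam w a b t)
      = cnj (f t * cnj (daughter (- \<alpha>) lam (\<lambda>x. cnj (w x)) a b t))" for t
    by (simp add: daughter_def c_vec_minus chirp_minus_angle)
  then show ?thesis
    unfolding mfrwt_chirped_def by (simp only: Bochner_Integration.integral_cnj)
qed

lemma mfrwt_chirped_parity:
  "mfrwt_chirped \<alpha> lam w (\<lambda>t. f (- t)) a b = mfrwt_chirped \<alpha> lam w f (- a) (- b)"
proof -
  define F where "F u = f u * cnj (daughter \<alpha> lam w (- a) (- b) u)" for u
  have arg: "vdivide (- t - - b) (- a) = vdivide (t - b) a" for t
    by (simp add: vec_eq_iff vdivide_def diff_divide_distrib)
  have "f (- t) * cnj (daughter \<alpha> lam w a b t) = F (- t)" for t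
    unfolding F_def daughter_def arg chirp_minus_arg mabs_minus ..
  then have "mfrwt_chirped \<alpha> lam w (\<lambda>t. f (- t)) a b = (\<integral>t. F (- t) \<partial>lebesgue)"
    by (simp add: mfrwt_chirped_def)
  also have "\<dots> = (\<integral>u. F u \<partial>lebesgue)"
    using integral_affine_scaleR[of "- 1" F 0] by simp
  finally show ?thesis
    by (simp add: mfrwt_chirped_def F_def)
qed

text \<open>
  After the substitution \<open>t = u + y\<close> the chirp splits as \<open>e(u + y) = e(u) e(y) exp(\<dots>)\<close> with a mixed
  exponential that is absorbed in \<open>f\<close>; the two chirps in \<open>b\<close> and \<open>b - y\<close> correct the prefactor of the
  daughter wavelet, which is attached to \<open>b\<close> on one side and to \<open>b - y\<close> on the other.
\<close>

lemma mfrwt_chirped_translation: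
  "mfrwt_chirped \<alpha> lam w (\<lambda>t. f (t - y)) a b
    = chirp \<alpha> (- lam\<^sup>2) b * chirp \<alpha> (lam\<^sup>2) (b - y) * chirp \<alpha> (lam\<^sup>2) y
      * mfrwt_chirped \<alpha> lam w
          (\<lambda>t. f t * exp (\<i> * of_real (lam\<^sup>2 * (\<Sum>k\<in>UNIV. 2 * a_coef (\<alpha> $ k) * t $ k * y $ k))))
          a (b - y)"
proof -
  define E where "E u = exp (\<i> * of_real (lam\<^sup>2 * (\<Sum>k\<in>UNIV. 2 * a_coef (\<alpha> $ k) * u $ k * y $ k)))"
    for u
  define A where "A = chirp \<alpha> (- lam\<^sup>2) b * chirp \<alpha> (lam\<^sup>2) (b - y) * chirp \<alpha> (lam\<^sup>2) y"
  define G where "G t = f (t - y) * cnj (daughter \<alpha> lam w a b t)" for t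
  have split: "chirp \<alpha> (lam\<^sup>2) (y + u) = chirp \<alpha> (lam\<^sup>2) u * chirp \<alpha> (lam\<^sup>2) y * E u" for u
    using chirp_add[of \<alpha> "lam\<^sup>2" u y] by (simp add: E_def add.commute)
  have arg: "y + u - b = u - (b - y)" for u
    by simp
  have "G (y + u) = A * (f u * E u * cnj (daughter \<alpha> lam w a (b - y) u))" for u
  proof -
    have "G (y + u) = chirp \<alpha> (- lam\<^sup>2) b * chirp \<alpha> (lam\<^sup>2) y * (f u * E u)
        * (c_vec \<alpha> lam * chirp \<alpha> (lam\<^sup>2) u * of_real (1 / sqrt (mabs a))
           * cnj (w (vdivide (u - (b - y)) a)))"
      by (simp add: G_def daughter_def cnj_chirp split arg)
    \<comment> \<open>Insert the prefactor of the daughter wavelet at \<open>b - y\<close> together with its inverse.\<close>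
    also have "\<dots> = (chirp \<alpha> (- lam\<^sup>2) (b - y) * chirp \<alpha> (lam\<^sup>2) (b - y)) * \<dots>"
      by (simp add: chirp_cancel)
    also have "\<dots> = A * (f u * E u * cnj (daughter \<alpha> lam w a (b - y) u))"
      by (simp add: A_def daughter_def cnj_chirp)
    finally show ?thesis .
  qed
  moreover have "(\<integral>t. G t \<partial>lebesgue) = (\<integral>u. G (y + u) \<partial>lebesgue)"
    using integral_affine_scaleR[of 1 G y] by simp
  ultimately have "(\<integral>t. G t \<partial>lebesgue)
      = A * (\<integral>u. f u * E u * cnj (daughter \<alpha> lam w a (b - y) u) \<partial>lebesgue)"
    by simp
  then show ?thesis
    unfolding mfrwt_chirped_def G_def A_def E_def .
qed

section \<open>The laws for the fractional wavelet transform\<close>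

lemma chirped_linear:
  "chirped \<alpha> lam (\<lambda>t. r * \<psi> t + s * \<phi> t) = (\<lambda>t. r * chirped \<alpha> lam \<psi> t + s * chirped \<alpha> lam \<phi> t)"
  by (simp add: chirped_def fun_eq_iff algebra_simps)

lemma chirped_cnj: "chirped (- \<alpha>) lam (\<lambda>t. cnj (\<psi> t)) = (\<lambda>t. cnj (chirped \<alpha> lam \<psi> t))"
  by (simp add: chirped_def fun_eq_iff chirp_minus_angle)

theorem theorem3p1:
  fixes \<alpha> :: "real ^ 'n" and lam \<sigma> :: real and r s :: complex
    and \<psi> \<phi> f g :: "real ^ 'n \<Rightarrow> complex" and a b :: "real ^ 'n"
  assumes "lam \<noteq> 0"
    and "\<And>k. \<alpha> $ k \<in> {-pi<..<pi} - {0}"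
    and "wavelet \<alpha> lam \<psi>" and "wavelet \<alpha> lam \<phi>"
    and "f \<in> L2" and "g \<in> L2"
    and "\<sigma> > 0"
    and "a \<in> R0"
  shows "(mfrwt \<alpha> lam \<psi> (\<lambda>t. r * f t + s * g t) a b
           = r * mfrwt \<alpha> lam \<psi> f a b + s * mfrwt \<alpha> lam \<psi> g a b)
    \<and> (mfrwt \<alpha> lam (\<lambda>t. r * \<psi> t + s * \<phi> t) f a b
           = cnj r * mfrwt \<alpha> lam \<psi> f a b + cnj s * mfrwt \<alpha> lam \<phi> f a b)
    \<and> (mfrwt \<alpha> lam \<psi> (\<lambda>t. f (\<sigma> *\<^sub>R t)) a b
           = (of_real (\<sigma> powr (real CARD('n) / 2)) * cnj (c_vec \<alpha> lam / c_vec \<alpha> (lam / \<sigma>)))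
             / of_real (\<sigma> ^ CARD('n))
             * mfrwt_chirped \<alpha> (lam / \<sigma>) (chirped \<alpha> lam \<psi>) f (\<sigma> *\<^sub>R a) (\<sigma> *\<^sub>R b))
    \<and> (mfrwt \<alpha> lam \<psi> (\<lambda>t. cnj (f t)) a b
           = cnj (mfrwt (- \<alpha>) lam (\<lambda>t. cnj (\<psi> t)) f a b))
    \<and> (mfrwt \<alpha> lam \<psi> (\<lambda>t. f (- t)) a b = mfrwt \<alpha> lam \<psi> f (- a) (- b))
    \<and> (\<forall>y. mfrwt \<alpha> lam \<psi> (\<lambda>t. f (t - y)) a b
           = chirp \<alpha> (- lam\<^sup>2) b * chirp \<alpha> (lam\<^sup>2) (b - y) * chirp \<alpha> (lam\<^sup>2) y
             * mfrwt \<alpha> lam \<psi>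
                 (\<lambda>t. f t * exp (\<i> * of_real (lam\<^sup>2 * (\<Sum>k\<in>UNIV. 2 * a_coef (\<alpha> $ k) * t $ k * y $ k))))
                 a (b - y))"
proof -
  have \<psi>: "chirped \<alpha> lam \<psi> \<in> L2" and \<phi>: "chirped \<alpha> lam \<phi> \<in> L2"
    using assms(3,4) by (auto simp: wavelet_def intro: chirped_L2)
  show ?thesis
    unfolding mfrwt_def chirped_linear chirped_cnj
    using mfrwt_chirped_linear[OF \<open>a \<in> R0\<close> \<psi> \<open>f \<in> L2\<close> \<open>g \<in> L2\<close>]
      mfrwt_chirped_antilinear_window[OF \<open>a \<in> R0\<close> \<psi> \<phi> \<open>f \<in> L2\<close>]
      mfrwt_chirped_dilation[OF \<open>\<sigma> > 0\<close>] mfrwt_chirped_cnj mfrwt_chirped_parity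
      mfrwt_chirped_translation
    by (intro conjI allI)
qed

end
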